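(* For $a>0$ and real $x$ with $|x|<a$, $$\sum_{n=1}^{\infty} H_n\,\zeta(n+1,a)\,x^n = \sum_{k=1}^{\infty}\frac{(-1)^{k-1}\zeta(k+1,a-x)}{k}x^k = \int_0^x \frac{\psi(a-x+t)-\psi(a-x)}{t}\,dt$$ and $$\sum_{n=1}^{\infty} H_n^-\,\zeta(n+1,a)\,x^n = \sum_{k=1}^{\infty}\frac{(-1)^{k-1}(2^k-1)\zeta(k+1,a-x)}{k}x^k = \int_0^x \frac{\psi(a-x+2t)-\psi(a-x+t)}{t}\,dt.$$
   Context: $\zeta(s,a)=\sum_{k=0}^\infty (k+a)^{-s}$ ($\mathrm{Re}\, s>1$, $a>0$) is the Hurwitz zeta function. $\psi=\Gamma'/\Gamma$ is the digamma function. $H_n=1+\frac12+\dots+\frac1n$ (harmonic numbers) and $H_n^- = 1-\frac12+\frac13-\dots+\frac{(-1)^{n-1}}{n}$ (skew-harmonic numbers), $n\ge1$.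
   Formalization: For a/2 < x < a (first line) and a/3 < x < a (second line) the middle series diverges; the formal theorem proves left series = integral for all |x|<a, and equality with the middle series exactly where it converges, x ≤ a/2 and x ≤ a/3 respectively. *)

theory Defs
  imports "HOL-Analysis.Analysis"
begin

text \<open>Meaningful for \<open>a > 0\<close> and \<open>Re s > 1\<close>. The type of \<open>s\<close> may be \<^typ>\<open>real\<close> or \<^typ>\<open>complex\<close>.\<close>

definition hurwitz_zeta :: "'a::ln \<Rightarrow> real \<Rightarrow> 'a" where
  "hurwitz_zeta s a = (\<Sum>k. of_real (real k + a) powr (- s))"

definition skew_harm :: "nat \<Rightarrow> real" where
  "skew_harm n = (\<Sum>k=1..n. (-1) ^ (k - 1) / real k)"

end

theory Submission
  imports Defs
begin

text \<open>
  Put \<open>b = a - x\<close> and \<open>L y = (\<Sum>m. ln (1 + y / (m + b)) / (m + b))\<close>. Expanding the zeta values and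
  summing over \<open>n\<close> first, with the generating functions \<open>- ln (1 - u) / (1 - u)\<close> of the harmonic
  numbers, \<open>ln (1 + u) / (1 - u)\<close> of the skew-harmonic numbers, and the logarithm series, identifies
  the first pair of series with \<open>L x\<close> and the second pair with \<open>L (2 x) - L x\<close>. The derivative of
  \<open>L\<close> at \<open>t\<close> is \<open>(\<Sum>m. 1 / ((m + b) (m + b + t))) = (\<psi> (b + t) - \<psi> b) / t\<close>, which gives the
  integrals. In the borderline cases \<open>x = a / 2\<close> and \<open>x = a / 3\<close> only the summand \<open>m = 0\<close> fails to
  converge absolutely in \<open>n\<close>, and it is an alternating harmonic series.
\<close>

section \<open>Hurwitz zeta values at integers as series over the shifts\<close>

lemma hurwitz_zeta_sums:
  fixes c :: real
  assumes "c > 0" and "n > 0"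
  shows "(\<lambda>m. 1 / (real m + c) ^ (n + 1)) sums hurwitz_zeta (real n + 1) c"
proof -
  have "(real m + c) powr (- (real n + 1)) = 1 / (real m + c) ^ (n + 1)" for m
  proof -
    have "(real m + c) powr (- (real n + 1)) = (real m + c) powr (- real (n + 1))"
      by (simp add: add.commute)
    also have "\<dots> = 1 / (real m + c) powr real (n + 1)"
      by (rule powr_minus_divide)
    also have "(real m + c) powr real (n + 1) = (real m + c) ^ (n + 1)"
      using assms by (intro powr_realpow) (simp add: add_nonneg_pos)
    finally show ?thesis .
  qed
  moreover have "summable (\<lambda>m. 1 / (real m + c) ^ (n + 1))"
    using Polygamma_converges'[of c "n + 1"] assms by (simp add: inverse_eq_divide add.commute)
  ultimately show ?thesis
    unfolding hurwitz_zeta_def by (simp add: summable_sums)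
qed

lemma summable_inverse_square_shift:
  fixes c :: real
  assumes "c > 0"
  shows "summable (\<lambda>m. 1 / (real m + c) ^ 2)"
  using hurwitz_zeta_sums[OF assms, of 1] by (auto simp: sums_iff numeral_2_eq_2)

lemma hurwitz_zeta_split_head:
  fixes c :: real
  assumes "c > 0" and "n > 0"
  shows "hurwitz_zeta (real n + 1) c = 1 / c ^ (n + 1) + hurwitz_zeta (real n + 1) (c + 1)"
proof -
  have "(\<lambda>m. 1 / (real (Suc m) + c) ^ (n + 1)) sums hurwitz_zeta (real n + 1) (c + 1)"
    using hurwitz_zeta_sums[of "c + 1" n] assms by (simp add: algebra_simps)
  then have "(\<lambda>m. 1 / (real m + c) ^ (n + 1)) sums
      (hurwitz_zeta (real n + 1) (c + 1) + 1 / (real 0 + c) ^ (n + 1))"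
    by (rule sums_Suc)
  with hurwitz_zeta_sums[OF assms] show ?thesis
    by (auto dest: sums_unique2)
qed

text \<open>Keeping only the summand \<open>m = 0\<close> already captures the geometric growth rate
  of the terms of the transformed series. This bound, together with the nonnegativity it implies,
  drives the divergence proofs.\<close>

lemma hurwitz_zeta_ge_head:
  fixes c :: real
  assumes "c > 0" and "n > 0"
  shows "hurwitz_zeta (real n + 1) c \<ge> 1 / c ^ (n + 1)"
proof -
  have "hurwitz_zeta (real n + 1) (c + 1) \<ge> 0"
    using hurwitz_zeta_sums[of "c + 1" n] assms
    by (intro sums_le[OF _ sums_zero, of _ "hurwitz_zeta (real n + 1) (c + 1)"]) auto
  with hurwitz_zeta_split_head[OF assms] show ?thesis by simp
qed

section \<open>Interchanging the sum over powers with the sum over shifts\<close>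

text \<open>Fubini for the double family indexed by the power \<open>n\<close> and the shift
  \<open>m\<close>. Summed over \<open>m\<close> first, it produces zeta values. Summed over
  \<open>n\<close> first, it produces the generating function \<open>g\<close> of the coefficients
  \<open>h\<close> at \<open>x / (m + c)\<close>. Absolute convergence at the single point
  \<open>x / c\<close>, the case \<open>m = 0\<close>, controls all shifts.\<close>

lemma hurwitz_zeta_power_series:
  fixes c x :: real and h :: "nat \<Rightarrow> real" and g :: "real \<Rightarrow> real"
  assumes c: "c > 0" and h: "summable (\<lambda>n. \<bar>h n\<bar> * \<bar>x / c\<bar> ^ n)"
    and g: "\<And>m. (\<lambda>n. h n * (x / (real m + c)) ^ (n + 1)) sums g (x / (real m + c))"
  shows "summable (\<lambda>m. g (x / (real m + c)) / (real m + c))" (is ?th1)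
    and "(\<lambda>n. h n * hurwitz_zeta (real (n + 1) + 1) c * x ^ (n + 1)) sums
           (\<Sum>m. g (x / (real m + c)) / (real m + c))" (is ?th2)
proof -
  define f where "f = (\<lambda>(n, m). h n * x ^ (n + 1) / (real m + c) ^ (n + 2))"
  \<comment> \<open>In the denominator \<open>(m + c) ^ (n + 2)\<close>, \<open>n\<close> factors
    are bounded below by \<open>c\<close> and two are kept for the sum over \<open>m\<close>. The
    majorant is thus a product of a function of \<open>n\<close> and a function of
    \<open>m\<close>.\<close>
  define B where "B = (\<lambda>(n, m). \<bar>h n\<bar> * \<bar>x / c\<bar> ^ n * \<bar>x\<bar> * (1 / (real m + c) ^ 2))"
  have pos: "real m + c > 0" for m using c by (simp add: add_nonneg_pos)
  have "B summable_on UNIV \<times> UNIV"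
  proof (rule summable_on_SigmaI[where g = "\<lambda>n. \<bar>h n\<bar> * \<bar>x / c\<bar> ^ n * \<bar>x\<bar> * hurwitz_zeta (real 1 + 1) c"])
    fix n :: nat
    have "(\<lambda>m. 1 / (real m + c) ^ 2) sums hurwitz_zeta (real 1 + 1) c"
      using hurwitz_zeta_sums[OF c, of 1] by (simp add: numeral_2_eq_2)
    then have "(\<lambda>m. B (n, m)) sums (\<bar>h n\<bar> * \<bar>x / c\<bar> ^ n * \<bar>x\<bar> * hurwitz_zeta (real 1 + 1) c)"
      unfolding B_def prod.case by (rule sums_mult)
    then show "((\<lambda>m. B (n, m)) has_sum (\<bar>h n\<bar> * \<bar>x / c\<bar> ^ n * \<bar>x\<bar> * hurwitz_zeta (real 1 + 1) c)) UNIV"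
      by (rule sums_nonneg_imp_has_sum) (simp add: B_def)
  next
    have "0 \<le> hurwitz_zeta (real 1 + 1) c"
      using hurwitz_zeta_ge_head[OF c, of 1] c by (smt (verit) zero_le_divide_1_iff zero_le_power zero_less_one)
    then show "(\<lambda>n. \<bar>h n\<bar> * \<bar>x / c\<bar> ^ n * \<bar>x\<bar> * hurwitz_zeta (real 1 + 1) c) summable_on UNIV"
      using h by (subst summable_on_UNIV_nonneg_real_iff) (auto intro!: summable_mult2)
  qed (auto simp: B_def)
  moreover have "norm (f p) \<le> B p" for p
  proof -
    obtain n m where p: "p = (n, m)" by (cases p)
    have "1 / (real m + c) ^ n \<le> 1 / c ^ n"
      using c pos[of m] by (intro divide_left_mono power_mono) auto
    then have "\<bar>h n\<bar> * \<bar>x\<bar> ^ (n + 1) / (real m + c) ^ 2 * (1 / (real m + c) ^ n)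
        \<le> \<bar>h n\<bar> * \<bar>x\<bar> ^ (n + 1) / (real m + c) ^ 2 * (1 / c ^ n)"
      by (intro mult_left_mono) auto
    moreover have "norm (f p) = \<bar>h n\<bar> * \<bar>x\<bar> ^ (n + 1) / (real m + c) ^ 2 * (1 / (real m + c) ^ n)"
      using pos[of m] by (simp add: p f_def abs_mult power_abs power_add power2_eq_square)
    moreover have "B p = \<bar>h n\<bar> * \<bar>x\<bar> ^ (n + 1) / (real m + c) ^ 2 * (1 / c ^ n)"
      using c by (simp add: p B_def power_divide mult_ac)
    ultimately show ?thesis by simp
  qed
  ultimately have "(\<lambda>p. norm (f p)) summable_on UNIV \<times> UNIV"
    by (rule Infinite_Sum.abs_summable_on_comparison_test')
  then have "f summable_on UNIV \<times> UNIV"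
    by (rule Infinite_Sum.abs_summable_summable)
  then obtain s where s: "(f has_sum s) (UNIV \<times> UNIV)"
    by (auto simp: summable_on_def)
  have row: "(\<lambda>m. f (n, m)) summable_on UNIV" "(\<lambda>n. f (n, m)) summable_on UNIV" for n m
    using summable_on_SigmaD1[of "\<lambda>n m. f (n, m)" UNIV "\<lambda>_. UNIV" n]
      summable_on_SigmaD1[of "\<lambda>m n. f (n, m)" UNIV "\<lambda>_. UNIV" m] s has_sum_swap[of f UNIV UNIV s]
    by (auto simp: summable_on_def)
  \<comment> \<open>Inner sum over the shifts: zeta values.\<close>
  have "((\<lambda>n. \<Sum>\<^sub>\<infinity>m. f (n, m)) has_sum s) UNIV"
    by (rule has_sum_Sigma'[OF s]) (use row in auto)
  moreover have "(\<Sum>\<^sub>\<infinity>m. f (n, m)) = h n * hurwitz_zeta (real (n + 1) + 1) c * x ^ (n + 1)" for n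
  proof -
    have "(\<lambda>m. f (n, m)) sums (\<Sum>\<^sub>\<infinity>m. f (n, m))"
      using row(1) by (intro has_sum_imp_sums) auto
    moreover have "(\<lambda>m. h n * x ^ (n + 1) * (1 / (real m + c) ^ (n + 1 + 1))) sums
        (h n * x ^ (n + 1) * hurwitz_zeta (real (n + 1) + 1) c)"
      by (intro sums_mult hurwitz_zeta_sums c) simp
    ultimately show ?thesis
      unfolding f_def by (auto dest: sums_unique2 simp: mult_ac)
  qed
  ultimately have S: "(\<lambda>n. h n * hurwitz_zeta (real (n + 1) + 1) c * x ^ (n + 1)) sums s"
    by (intro has_sum_imp_sums) simp
  \<comment> \<open>Inner sum over the powers: values of \<open>g\<close>, with the same total
    \<open>s\<close>.\<close>
  have "((\<lambda>(m, n). f (n, m)) has_sum s) (UNIV \<times> UNIV)"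
    using s by (subst (asm) has_sum_swap)
  then have "((\<lambda>m. \<Sum>\<^sub>\<infinity>n. f (n, m)) has_sum s) UNIV"
    by (rule has_sum_Sigma'[where f = "\<lambda>(m, n). f (n, m)", unfolded prod.case]) (use row in auto)
  moreover have "(\<Sum>\<^sub>\<infinity>n. f (n, m)) = g (x / (real m + c)) / (real m + c)" for m
  proof -
    have "(\<lambda>n. f (n, m)) sums (\<Sum>\<^sub>\<infinity>n. f (n, m))"
      using row(2) by (intro has_sum_imp_sums) auto
    moreover have "(\<lambda>n. h n * (x / (real m + c)) ^ (n + 1) / (real m + c)) sums
        (g (x / (real m + c)) / (real m + c))"
      by (intro sums_divide g)
    ultimately show ?thesis
      using pos[of m] unfolding f_def by (auto dest: sums_unique2 simp: power_divide mult_ac)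
  qed
  ultimately have "(\<lambda>m. g (x / (real m + c)) / (real m + c)) sums s"
    by (intro has_sum_imp_sums) simp
  with S show ?th1 ?th2 by (auto simp: sums_iff)
qed

section \<open>Logarithm series and generating functions of partial sums\<close>

text \<open>The endpoint \<open>y = 1\<close>, where convergence is only conditional, is included
  because the borderline cases of the theorem land exactly there.\<close>

lemma ln_one_plus_sums:
  fixes y :: real
  assumes "-1 < y" and "y \<le> 1"
  shows "(\<lambda>n. (-1) ^ n / real (n + 1) * y ^ (n + 1)) sums ln (1 + y)"
proof (cases "y = 1")
  case True
  then show ?thesis using alternating_harmonic_series_sums by simp
next
  case False
  with assms have "(\<lambda>n. - ((- y) ^ n) / real n) sums ln (1 + y)"
    by (intro ln_series') auto
  \<comment> \<open>The dropped term has index 0; it is divided by \<open>real 0\<close> and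
    therefore equals 0.\<close>
  then have "(\<lambda>n. - ((- y) ^ Suc n) / real (Suc n)) sums ln (1 + y)"
    by (subst sums_Suc_iff) simp
  moreover have "- ((- y) ^ Suc n) / real (Suc n) = (-1) ^ n / real (n + 1) * y ^ (n + 1)" for n
    using power_minus[of y n] by simp
  ultimately show ?thesis by (simp only:)
qed

text \<open>Cauchy product with the geometric series: dividing a generating function by
  \<open>1 - y\<close> replaces its coefficients by their partial sums. With coefficients
  \<open>1 / (k + 1)\<close> or \<open>(-1) ^ k / (k + 1)\<close> these are the harmonic or the
  skew-harmonic numbers.\<close>

lemma partial_sums_power_series:
  fixes d :: "nat \<Rightarrow> real" and y s :: real
  assumes "\<bar>y\<bar> < 1" and "\<And>n. \<bar>d n\<bar> \<le> 1" and s: "(\<lambda>n. d n * y ^ (n + 1)) sums s"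
  shows "(\<lambda>n. (\<Sum>k\<le>n. d k) * y ^ (n + 1)) sums (s / (1 - y))"
proof -
  have geo: "summable (\<lambda>n. norm (y ^ n))"
    using assms(1) by (simp add: power_abs)
  have "summable (\<lambda>n. norm (d n * y ^ (n + 1)))"
  proof (rule summable_comparison_test')
    show "summable (\<lambda>n. \<bar>y\<bar> ^ (n + 1))"
      using assms(1) by simp
    show "norm (norm (d n * y ^ (n + 1))) \<le> \<bar>y\<bar> ^ (n + 1)" if "n \<ge> 0" for n
      using mult_right_mono[OF assms(2)[of n], of "\<bar>y\<bar> ^ (n + 1)"]
      by (simp add: abs_mult power_abs)
  qed
  from Cauchy_product_sums[OF this geo]
  have "(\<lambda>n. \<Sum>k\<le>n. d k * y ^ (k + 1) * y ^ (n - k)) sums (s * (1 / (1 - y)))"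
    using s assms(1) by (simp add: suminf_geometric sums_iff)
  moreover have "(\<Sum>k\<le>n. d k * y ^ (k + 1) * y ^ (n - k)) = (\<Sum>k\<le>n. d k) * y ^ (n + 1)" for n
    unfolding sum_distrib_right
    by (intro sum.cong) (auto simp: mult.assoc simp flip: power_add)
  ultimately show ?thesis by simp
qed

text \<open>The partial sums grow at most like \<open>n + 1\<close>, so the derivative of the
  geometric series is a majorant. This supplies the summability required for the interchange of
  sums.\<close>

lemma summable_partial_sums_power:
  fixes d :: "nat \<Rightarrow> real" and r :: real
  assumes "0 \<le> r" and "r < 1" and "\<And>n. \<bar>d n\<bar> \<le> 1"
  shows "summable (\<lambda>n. \<bar>\<Sum>k\<le>n. d k\<bar> * r ^ n)"
proof (rule summable_comparison_test')
  show "summable (\<lambda>n. real (n + 1) * r ^ n)"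
    using geometric_deriv_sums[of r] assms by (simp add: sums_iff add.commute)
  show "norm (\<bar>\<Sum>k\<le>n. d k\<bar> * r ^ n) \<le> real (n + 1) * r ^ n" if "n \<ge> 0" for n
  proof -
    have "\<bar>\<Sum>k\<le>n. d k\<bar> \<le> (\<Sum>k\<le>n. \<bar>d k\<bar>)" by (rule sum_abs)
    also have "\<dots> \<le> (\<Sum>k\<le>n. 1)" by (intro sum_mono assms)
    finally show ?thesis using assms by (simp add: mult_right_mono abs_mult)
  qed
qed

lemma harm_eq_sum_atMost: "harm (n + 1) = (\<Sum>k\<le>n. 1 / real (k + 1))"
  by (induction n) (simp_all add: harm_def inverse_eq_divide)

lemma skew_harm_eq_sum_atMost: "skew_harm (n + 1) = (\<Sum>k\<le>n. (-1) ^ k / real (k + 1))"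
  by (induction n) (simp_all add: skew_harm_def)

section \<open>The logarithmic sum \<open>L\<close> and its derivative\<close>

text \<open>The function \<open>L\<close> with \<open>b\<close> as an explicit parameter, since
  splitting off the summand \<open>m = 0\<close> turns \<open>b\<close> into
  \<open>b + 1\<close>.\<close>

definition shifted_ln_sum :: "real \<Rightarrow> real \<Rightarrow> real" where
  "shifted_ln_sum b y = (\<Sum>m. ln (1 + y / (real m + b)) / (real m + b))"

text \<open>At \<open>t = 0\<close> the difference quotient itself has the junk value \<open>0\<close>.\<close>

definition Digamma_slope :: "real \<Rightarrow> real \<Rightarrow> real" where
  "Digamma_slope b t = (if t = 0 then Polygamma 1 b else (Digamma (b + t) - Digamma b) / t)"

text \<open>Subtracting the series of \<open>Digamma\<close> at \<open>b\<close> from the one at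
  \<open>b + t\<close> cancels the Euler constant and the harmonic terms, and partial fractions give
  the rest. At \<open>t = 0\<close> it is the series of the trigamma function.\<close>

lemma Digamma_slope_sums:
  assumes "b > 0" and "b + t > 0"
  shows "(\<lambda>m. 1 / ((real m + b) * (real m + b + t))) sums Digamma_slope b t"
proof (cases "t = 0")
  case True
  have "(\<lambda>m. 1 / (real m + b) ^ 2) sums (\<Sum>m. 1 / (real m + b) ^ 2)"
    by (intro summable_sums summable_inverse_square_shift assms)
  then show ?thesis
    using True by (simp add: Digamma_slope_def Polygamma_def power2_eq_square inverse_eq_divide add.commute)
next
  case False
  have pos: "real m + b > 0" "real m + b + t > 0" for m
    using assms by (simp_all add: add_nonneg_pos add.assoc)
  have D: "(\<lambda>m. inverse (real (Suc m)) - inverse (z + real m)) sums (Digamma z + euler_mascheroni)"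
    if "z > 0" for z :: real
    using summable_sums[OF summable_Digamma[of z]] that by (simp add: Digamma_def)
  have "(\<lambda>m. (inverse (b + real m) - inverse (b + t + real m)) / t) sums
      ((Digamma (b + t) - Digamma b) / t)"
    using sums_divide[OF sums_diff[OF D[OF assms(2)] D[OF assms(1)]], of t] by simp
  moreover have "(inverse (b + real m) - inverse (b + t + real m)) / t
      = 1 / ((real m + b) * (real m + b + t))" for m
  proof -
    have "(inverse u - inverse (u + t)) / t = 1 / (u * (u + t))" if "u > 0" "u + t > 0" for u
      using that False by (simp add: divide_simps)
    from this[OF pos(1)[of m] pos(2)[of m]] show ?thesis by (simp add: add_ac)
  qed
  ultimately show ?thesis using False by (simp add: Digamma_slope_def)
qed

text \<open>At 0 this is the differentiability of \<open>Digamma\<close> at \<open>b\<close>.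
  Elsewhere the slope agrees locally with the plain quotient.\<close>

lemma isCont_Digamma_slope:
  assumes "b > 0" and "b + t > 0"
  shows "isCont (Digamma_slope b) t"
proof (cases "t = 0")
  case True
  have "(Digamma has_field_derivative Polygamma 1 b) (at b)"
    using has_field_derivative_Polygamma[of b 0] nonpos_Ints_nonpos[of b] assms(1) by auto
  then have "(\<lambda>h. (Digamma (b + h) - Digamma b) / h) \<midarrow>0\<rightarrow> Polygamma 1 b"
    by (simp add: DERIV_def)
  then have "Digamma_slope b \<midarrow>0\<rightarrow> Polygamma 1 b"
    by (rule Lim_transform_within[OF _ zero_less_one]) (simp add: Digamma_slope_def)
  then show ?thesis using True by (simp add: isCont_def Digamma_slope_def)
next
  case False
  have "b + t \<notin> \<int>\<^sub>\<le>\<^sub>0" using assms by auto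
  then have "isCont (\<lambda>t. (Digamma (b + t) - Digamma b) / t) t"
    using False by (auto intro!: continuous_intros)
  moreover have "eventually (\<lambda>u. Digamma_slope b u = (Digamma (b + u) - Digamma b) / u) (nhds t)"
    using t1_space_nhds[OF False] by eventually_elim (simp add: Digamma_slope_def)
  ultimately show ?thesis by (simp add: isCont_cong)
qed

text \<open>Termwise differentiation on a half-line containing both 0 and \<open>y\<close>,
  justified by the Weierstrass M-test. Convergence at \<open>y\<close> is inherited from 0, where
  every summand vanishes.\<close>

lemma shifted_ln_sum_sums_and_deriv:
  assumes b: "b > 0" and y: "b + y > 0"
  shows "(\<lambda>m. ln (1 + y / (real m + b)) / (real m + b)) sums shifted_ln_sum b y" (is ?sums)
    and "(shifted_ln_sum b has_real_derivative Digamma_slope b y) (at y)" (is ?deriv)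
proof -
  \<comment> \<open>The bound \<open>\<delta> < b\<close> puts 0 into the half-line
    \<open>?S\<close>, and \<open>\<delta> < b + y\<close> puts \<open>y\<close> there. On
    \<open>?S\<close> both \<open>m + b\<close> and \<open>m + b + t\<close> are at least
    \<open>m + \<delta>\<close>, which yields the majorant
    \<open>1 / (m + \<delta>) ^ 2\<close>.\<close>
  obtain \<delta> where \<delta>: "0 < \<delta>" "\<delta> < b" "\<delta> < b + y"
    using dense[of 0 "min b (b + y)"] b y by auto
  define f where "f = (\<lambda>m y. ln (1 + y / (real m + b)) / (real m + b))"
  define f' where "f' = (\<lambda>m t. 1 / ((real m + b) * (real m + b + t)))"
  let ?S = "{\<delta> - b<..}"
  have pos: "real m + b > 0" for m using b by (simp add: add_nonneg_pos)
  have deriv: "(f m has_real_derivative f' m t) (at t within ?S)" if "t \<in> ?S" for m t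
  proof -
    have "real m + b + t > 0" using that \<delta> by (smt (verit) greaterThan_iff of_nat_0_le_iff)
    moreover from this pos[of m] have "1 + t / (real m + b) > 0" by (simp add: field_simps)
    moreover have "1 / u * (1 / (1 + t / u)) / u = 1 / (u * (u + t))" if "u > 0" "u + t > 0" for u
      using that by (simp add: divide_simps)
    ultimately show ?thesis
      using pos[of m] unfolding f_def f'_def
      by (auto intro!: derivative_eq_intros)
  qed
  have conv: "uniformly_convergent_on ?S (\<lambda>n t. \<Sum>m<n. f' m t)"
  proof (rule Weierstrass_m_test')
    show "summable (\<lambda>m. 1 / (real m + \<delta>) ^ 2)"
      using \<delta> by (intro summable_inverse_square_shift)
    show "norm (f' m t) \<le> 1 / (real m + \<delta>) ^ 2" if "t \<in> ?S" for m t
    proof -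
      have d: "0 < real m + \<delta>" "real m + \<delta> \<le> real m + b" "real m + \<delta> \<le> real m + b + t"
        using \<delta> that by (auto simp: add_nonneg_pos)
      then have "(real m + \<delta>) ^ 2 \<le> (real m + b) * (real m + b + t)"
        unfolding power2_eq_square by (intro mult_mono) auto
      moreover have "norm (f' m t) = f' m t" using d by (simp add: f'_def)
      ultimately show ?thesis
        unfolding f'_def using d by (simp add: frac_le)
    qed
  qed
  have S: "convex ?S" "0 \<in> ?S" "summable (\<lambda>m. f m 0)" "y \<in> interior ?S"
    using \<delta> by (auto simp: f_def interior_open)
  have "summable (\<lambda>m. f m y)"
    by (rule has_field_derivative_series'(1)[OF S(1) deriv conv S(2-4)])
  then show ?sums by (simp add: f_def shifted_ln_sum_def summable_sums)
  have "((\<lambda>y. \<Sum>m. f m y) has_real_derivative (\<Sum>m. f' m y)) (at y)"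
    by (rule has_field_derivative_series'(2)[OF S(1) deriv conv S(2-4)])
  moreover have "(\<Sum>m. f' m y) = Digamma_slope b y"
    using Digamma_slope_sums[OF b y] by (simp add: f'_def sums_iff)
  moreover have "(\<lambda>y. \<Sum>m. f m y) = shifted_ln_sum b"
    by (simp add: f_def shifted_ln_sum_def fun_eq_iff)
  ultimately show ?deriv by simp
qed

lemma shifted_ln_sum_split_head:
  assumes "b > 0" and "b + y > 0"
  shows "shifted_ln_sum b y = ln (1 + y / b) / b + shifted_ln_sum (b + 1) y"
proof -
  have "(\<lambda>m. ln (1 + y / (real (Suc m) + b)) / (real (Suc m) + b)) sums shifted_ln_sum (b + 1) y"
    using shifted_ln_sum_sums_and_deriv(1)[of "b + 1" y] assms by (simp add: algebra_simps)
  from sums_Suc[OF this] shifted_ln_sum_sums_and_deriv(1)[OF assms] show ?thesis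
    by (auto dest: sums_unique2)
qed

section \<open>The alternating zeta series, and a divergence criterion\<close>

text \<open>At \<open>y = b\<close> the summand \<open>m = 0\<close> converges only conditionally,
  so the interchange of sums is applied to the shift \<open>b + 1\<close>, where all ratios stay
  below 1 in absolute value. The head is the logarithm series at \<open>y / b\<close>, endpoint
  included, and is added back afterwards.\<close>

lemma alternating_hurwitz_zeta_series:
  assumes b: "b > 0" and y: "- b < y" "y \<le> b"
  shows "(\<lambda>k. (-1) ^ k * hurwitz_zeta (real (k + 1) + 1) b / real (k + 1) * y ^ (k + 1))
           sums shifted_ln_sum b y"
proof -
  have q: "\<bar>y / (real m + (b + 1))\<bar> < 1" "- 1 < y / (real m + (b + 1))" "y / (real m + (b + 1)) < 1" for m
    using b y by (simp_all add: abs_less_iff field_simps)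
  have tail: "(\<lambda>k. (-1) ^ k / real (k + 1) * hurwitz_zeta (real (k + 1) + 1) (b + 1) * y ^ (k + 1))
      sums shifted_ln_sum (b + 1) y"
    unfolding shifted_ln_sum_def
  proof (rule hurwitz_zeta_power_series(2)[where g = "\<lambda>u. ln (1 + u)"])
    show "summable (\<lambda>n. \<bar>(-1) ^ n / real (n + 1)\<bar> * \<bar>y / (b + 1)\<bar> ^ n)"
    proof (rule summable_comparison_test')
      show "summable (\<lambda>n. \<bar>y / (b + 1)\<bar> ^ n)"
        using q(1)[of 0] by (intro summable_geometric) simp
      show "norm (\<bar>(-1) ^ n / real (n + 1)\<bar> * \<bar>y / (b + 1)\<bar> ^ n) \<le> \<bar>y / (b + 1)\<bar> ^ n"
        if "n \<ge> 0" for n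
        using mult_left_le_one_le[of "\<bar>y / (b + 1)\<bar> ^ n" "\<bar>(-1) ^ n / real (n + 1)\<bar>"] by simp
    qed
    show "(\<lambda>n. (-1) ^ n / real (n + 1) * (y / (real m + (b + 1))) ^ (n + 1))
        sums ln (1 + y / (real m + (b + 1)))" for m
      using q[of m] by (intro ln_one_plus_sums) linarith+
  qed (use b in simp)
  have "(\<lambda>k. (-1) ^ k / real (k + 1) * (y / b) ^ (k + 1) / b) sums (ln (1 + y / b) / b)"
    using b y by (intro sums_divide ln_one_plus_sums) (auto simp: field_simps)
  from sums_add[OF this tail] have "(\<lambda>k. (-1) ^ k / real (k + 1) * (y / b) ^ (k + 1) / b
      + (-1) ^ k / real (k + 1) * hurwitz_zeta (real (k + 1) + 1) (b + 1) * y ^ (k + 1))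
      sums shifted_ln_sum b y"
    using b y by (subst shifted_ln_sum_split_head) auto
  moreover have "(-1) ^ k / real (k + 1) * (y / b) ^ (k + 1) / b
      + (-1) ^ k / real (k + 1) * hurwitz_zeta (real (k + 1) + 1) (b + 1) * y ^ (k + 1)
      = (-1) ^ k * hurwitz_zeta (real (k + 1) + 1) b / real (k + 1) * y ^ (k + 1)" for k
    using b hurwitz_zeta_split_head[OF b, of "k + 1"]
    by (simp add: power_divide distrib_left distrib_right add_divide_distrib)
  ultimately show ?thesis by (simp only:)
qed

text \<open>By Bernoulli's inequality \<open>r ^ (k + 1) / (k + 1)\<close> is at least
  \<open>r - 1\<close>, so the terms stay away from 0.\<close>

lemma not_summable_power_over_nat:
  fixes r C :: real
  assumes "r > 1" and "C > 0" and "\<And>k. \<bar>f k\<bar> \<ge> C * r ^ (k + 1) / real (k + 1)"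
  shows "\<not> summable f"
proof
  assume "summable f"
  then have "(\<lambda>k. \<bar>f k\<bar>) \<longlonglongrightarrow> 0"
    by (intro tendsto_rabs_zero summable_LIMSEQ_zero)
  then have "eventually (\<lambda>k. \<bar>f k\<bar> < C * (r - 1)) sequentially"
    using assms by (intro order_tendstoD(2)[of _ 0]) auto
  then obtain k where k: "\<bar>f k\<bar> < C * (r - 1)"
    by (auto simp: eventually_sequentially)
  have "1 + real (k + 1) * (r - 1) \<le> (1 + (r - 1)) ^ (k + 1)"
    using assms by (intro Bernoulli_inequality) auto
  then have "r - 1 \<le> r ^ (k + 1) / real (k + 1)"
    by (simp add: pos_le_divide_eq mult.commute)
  then have "C * (r - 1) \<le> C * r ^ (k + 1) / real (k + 1)"
    using mult_left_mono[of "r - 1" _ C] assms(2) by fastforce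
  with k assms(3)[of k] show False by simp
qed

section \<open>Integrals with a removable singularity at 0\<close>

text \<open>The quotients to be integrated have a junk value at 0, but the interval integral runs
  over an open interval with endpoint 0. Hence \<open>f\<close> may be replaced by its continuous
  extension \<open>\<phi>\<close>, to which the fundamental theorem applies. The use of
  \<open>min\<close> and \<open>max\<close> covers both signs of \<open>x\<close>.\<close>

lemma interval_integral_FTC_off_zero:
  fixes f \<phi> F :: "real \<Rightarrow> real"
  assumes F: "\<And>t. min 0 x \<le> t \<Longrightarrow> t \<le> max 0 x \<Longrightarrow> (F has_real_derivative \<phi> t) (at t)"
    and \<phi>: "\<And>t. min 0 x \<le> t \<Longrightarrow> t \<le> max 0 x \<Longrightarrow> isCont \<phi> t"
    and eq: "\<And>t. t \<noteq> 0 \<Longrightarrow> f t = \<phi> t"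
  shows "interval_lebesgue_integrable lborel 0 x f" and "(LBINT t=0..x. f t) = F x - F 0"
proof -
  have "interval_lebesgue_integrable lborel (ereal 0) x \<phi>"
    by (rule interval_integrable_isCont) (use \<phi> in auto)
  moreover have "set_integrable lborel A f \<longleftrightarrow> set_integrable lborel A \<phi>" if "0 \<notin> A" for A
    using that by (intro set_integrable_cong refl eq) auto
  then have "interval_lebesgue_integrable lborel (ereal 0) x f
      \<longleftrightarrow> interval_lebesgue_integrable lborel (ereal 0) x \<phi>"
    by (simp add: interval_lebesgue_integrable_def einterval_iff)
  ultimately show "interval_lebesgue_integrable lborel 0 x f"
    by (simp add: zero_ereal_def)
  have "(LBINT t=ereal 0..x. f t) = (LBINT t=ereal 0..x. \<phi> t)"
    by (intro interval_integral_cong eq) (auto simp: einterval_iff min_def max_def split: if_splits)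
  also have "\<dots> = F x - F 0"
  proof (rule interval_integral_FTC_finite)
    show "continuous_on {min 0 x..max 0 x} \<phi>"
      using \<phi> by (intro continuous_at_imp_continuous_on) auto
    show "(F has_vector_derivative \<phi> t) (at t within {min 0 x..max 0 x})"
      if "min 0 x \<le> t" "t \<le> max 0 x" for t
      using F[OF that] has_field_derivative_at_within
      by (auto simp: has_real_derivative_iff_has_vector_derivative[symmetric])
  qed
  finally show "(LBINT t=0..x. f t) = F x - F 0" by (simp add: zero_ereal_def)
qed

section \<open>Evaluation of both pairs of series and of both integrals\<close>

text \<open>The series in powers of \<open>x\<close> with zeta values at \<open>a - x\<close> do not
  converge for every \<open>x\<close> with \<open>\<bar>x\<bar> < a\<close>. Their equality with the
  integrals is therefore stated under summability, and the exact range of summability is part of the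
  conclusion. Index 0 of each sequence is the term with index 1 of the sums.\<close>

theorem theorem3:
  fixes a x :: real
  assumes "a > 0" and "\<bar>x\<bar> < a"
  defines "S1 \<equiv> (\<lambda>n. harm (n + 1) * hurwitz_zeta (real (n + 1) + 1) a * x ^ (n + 1))"
    and "T1 \<equiv> (\<lambda>k. (-1) ^ k * hurwitz_zeta (real (k + 1) + 1) (a - x) / real (k + 1) * x ^ (k + 1))"
    and "f1 \<equiv> (\<lambda>t. (Digamma (a - x + t) - Digamma (a - x)) / t)"
    and "S2 \<equiv> (\<lambda>n. skew_harm (n + 1) * hurwitz_zeta (real (n + 1) + 1) a * x ^ (n + 1))"
    and "T2 \<equiv> (\<lambda>k. (-1) ^ k * (2 ^ (k + 1) - 1) * hurwitz_zeta (real (k + 1) + 1) (a - x)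
                    / real (k + 1) * x ^ (k + 1))"
    and "f2 \<equiv> (\<lambda>t. (Digamma (a - x + 2 * t) - Digamma (a - x + t)) / t)"
  shows "interval_lebesgue_integrable lborel 0 x f1
       \<and> S1 sums (LBINT t=0..x. f1 t)
       \<and> (summable T1 \<longleftrightarrow> x \<le> a / 2)
       \<and> (summable T1 \<longrightarrow> T1 sums (LBINT t=0..x. f1 t))
       \<and> interval_lebesgue_integrable lborel 0 x f2
       \<and> S2 sums (LBINT t=0..x. f2 t)
       \<and> (summable T2 \<longleftrightarrow> x \<le> a / 3)
       \<and> (summable T2 \<longrightarrow> T2 sums (LBINT t=0..x. f2 t))"
proof -
  define b where "b = a - x"
  let ?L = "shifted_ln_sum b"
  \<comment> \<open>Here \<open>b + x = a\<close> and \<open>b + 2 * x = a + x\<close>.\<close>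
  have b: "b > 0" and bx: "b + x > 0" "b + 2 * x > 0"
    using assms(1,2) by (auto simp: b_def)
  have rng: "b + t > 0" "b + 2 * t > 0" if "min 0 x \<le> t" "t \<le> max 0 x" for t
    using b bx that by (auto simp: min_def max_def split: if_splits)
  have pos: "real m + a > 0" "real m + b > 0" "\<bar>x\<bar> < real m + a" for m
    using assms(1,2) b by (auto simp: add_nonneg_pos)
  have q: "\<bar>x / (real m + a)\<bar> < 1" for m
    using pos[of m] by (simp add: abs_divide)
  then have q': "- 1 < x / (real m + a)" "x / (real m + a) < 1" for m
    by (simp_all only: abs_less_iff minus_less_iff)
  have frac: "1 - x / (real m + a) = (real m + b) / (real m + a)"
      "1 + x / (real m + b) = (real m + a) / (real m + b)" for m
    using pos[of m] by (simp_all add: b_def field_simps)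
  \<comment> \<open>The factor \<open>1 / (1 - u)\<close> of both generating functions converts the
    weight \<open>1 / (m + a)\<close> into \<open>1 / (m + b)\<close>.\<close>
  have quot: "u / (1 - x / (real m + a)) / (real m + a) = u / (real m + b)" for u m
    unfolding frac(1) using pos[of m] by simp
  have L0: "?L 0 = 0" by (simp add: shifted_ln_sum_def)

  have f1_eq: "f1 t = Digamma_slope b t" if "t \<noteq> 0" for t
    using that by (simp add: f1_def Digamma_slope_def b_def)
  note f1 = interval_integral_FTC_off_zero[OF shifted_ln_sum_sums_and_deriv(2)[OF b rng(1)]
      isCont_Digamma_slope[OF b rng(1)] f1_eq]
  define F where "F = (\<lambda>t. ?L (2 * t) - ?L t)"
  \<comment> \<open>This is the derivative of \<open>F\<close> by the chain rule. For nonzero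
    \<open>t\<close> the two occurrences of \<open>Digamma b\<close> cancel, which leaves
    \<open>f2 t\<close>.\<close>
  define \<phi> where "\<phi> = (\<lambda>t. 2 * Digamma_slope b (2 * t) - Digamma_slope b t)"
  have F: "(F has_real_derivative \<phi> t) (at t)" if "min 0 x \<le> t" "t \<le> max 0 x" for t
    unfolding F_def \<phi>_def
    by (rule derivative_eq_intros DERIV_chain'[where g = ?L and f = "\<lambda>t. 2 * t"]
          shifted_ln_sum_sums_and_deriv(2)[OF b] rng[OF that] refl | simp)+
  have \<phi>: "isCont \<phi> t" if "min 0 x \<le> t" "t \<le> max 0 x" for t
    unfolding \<phi>_def using rng[OF that] b
    by (intro continuous_intros isCont_o2[where f = "\<lambda>t. 2 * t"] isCont_Digamma_slope) auto
  have f2_eq: "f2 t = \<phi> t" if "t \<noteq> 0" for t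
    using that by (simp add: f2_def \<phi>_def Digamma_slope_def b_def field_simps)
  note f2 = interval_integral_FTC_off_zero[OF F \<phi> f2_eq]
  have I1: "(LBINT t=0..x. f1 t) = ?L x" using f1(2) L0 by simp
  have I2: "(LBINT t=0..x. f2 t) = ?L (2 * x) - ?L x" using f2(2) L0 by (simp add: F_def)

  have S1: "S1 sums ?L x"
  proof -
    have "S1 sums (\<Sum>m. - ln (1 - x / (real m + a)) / (1 - x / (real m + a)) / (real m + a))"
      unfolding S1_def harm_eq_sum_atMost
    proof (rule hurwitz_zeta_power_series(2)[where g = "\<lambda>u. - ln (1 - u) / (1 - u)"])
      show "summable (\<lambda>n. \<bar>\<Sum>k\<le>n. 1 / real (k + 1)\<bar> * \<bar>x / a\<bar> ^ n)"
        using q[of 0] by (intro summable_partial_sums_power) auto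
      show "(\<lambda>n. (\<Sum>k\<le>n. 1 / real (k + 1)) * (x / (real m + a)) ^ (n + 1)) sums
          (- ln (1 - x / (real m + a)) / (1 - x / (real m + a)))" for m
      proof (intro partial_sums_power_series)
        let ?u = "x / (real m + a)"
        have "(\<lambda>n. - ((-1) ^ n / real (n + 1) * (- ?u) ^ (n + 1))) sums - ln (1 + (- ?u))"
          using q'[of m] by (intro sums_minus ln_one_plus_sums) auto
        moreover have "- ((-1) ^ n / real (n + 1) * (- ?u) ^ (n + 1)) = 1 / real (n + 1) * ?u ^ (n + 1)" for n
          using power_minus[of ?u n] by (simp add: field_simps)
        ultimately show "(\<lambda>n. 1 / real (n + 1) * ?u ^ (n + 1)) sums - ln (1 - ?u)"
          by (simp only: add_uminus_conv_diff)
      qed (use q in auto)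
    qed (use assms in auto)
    also have "(\<lambda>m. - ln (1 - x / (real m + a)) / (1 - x / (real m + a)) / (real m + a))
        = (\<lambda>m. ln (1 + x / (real m + b)) / (real m + b))"
    proof
      fix m
      \<comment> \<open>The two fractions in \<open>frac\<close> are reciprocal, so
        \<open>- ln (1 - u)\<close> becomes a summand of \<open>L x\<close>.\<close>
      have "1 + x / (real m + b) = inverse (1 - x / (real m + a))"
        unfolding frac by simp
      then have "ln (1 + x / (real m + b)) = - ln (1 - x / (real m + a))"
        by (simp add: ln_inverse)
      then show "- ln (1 - x / (real m + a)) / (1 - x / (real m + a)) / (real m + a)
          = ln (1 + x / (real m + b)) / (real m + b)"
        by (simp only: quot)
    qed
    finally show ?thesis by (simp add: shifted_ln_sum_def)
  qed

  have S2: "S2 sums (?L (2 * x) - ?L x)"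
  proof -
    have "S2 sums (\<Sum>m. ln (1 + x / (real m + a)) / (1 - x / (real m + a)) / (real m + a))"
      unfolding S2_def skew_harm_eq_sum_atMost
    proof (rule hurwitz_zeta_power_series(2)[where g = "\<lambda>u. ln (1 + u) / (1 - u)"])
      show "summable (\<lambda>n. \<bar>\<Sum>k\<le>n. (-1) ^ k / real (k + 1)\<bar> * \<bar>x / a\<bar> ^ n)"
        using q[of 0] by (intro summable_partial_sums_power) auto
      show "(\<lambda>n. (\<Sum>k\<le>n. (-1) ^ k / real (k + 1)) * (x / (real m + a)) ^ (n + 1)) sums
          (ln (1 + x / (real m + a)) / (1 - x / (real m + a)))" for m
        using q[of m] q'[of m] by (intro partial_sums_power_series ln_one_plus_sums) auto
    qed (use assms in auto)
    also have "(\<lambda>m. ln (1 + x / (real m + a)) / (1 - x / (real m + a)) / (real m + a))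
        = (\<lambda>m. ln (1 + 2 * x / (real m + b)) / (real m + b) - ln (1 + x / (real m + b)) / (real m + b))"
    proof
      fix m
      have "1 + x / (real m + b) > 0" "1 + x / (real m + a) > 0"
        using pos[of m] by (auto simp: b_def field_simps)
      \<comment> \<open>This factorization splits \<open>ln (1 + u)\<close> into the difference of
        the summands of \<open>L (2 * x)\<close> and \<open>L x\<close>.\<close>
      moreover have "1 + 2 * x / (real m + b) = (1 + x / (real m + a)) * (1 + x / (real m + b))"
      proof -
        have "1 + x / (real m + a) = (real m + a + x) / (real m + a)"
          "1 + 2 * x / (real m + b) = (real m + a + x) / (real m + b)"
          using pos[of m] by (simp_all add: b_def field_simps)
        with pos(1)[of m] show ?thesis unfolding frac(2) by simp
      qed
      ultimately have "ln (1 + x / (real m + a)) = ln (1 + 2 * x / (real m + b)) - ln (1 + x / (real m + b))"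
        by (simp add: ln_mult)
      then show "ln (1 + x / (real m + a)) / (1 - x / (real m + a)) / (real m + a)
        = ln (1 + 2 * x / (real m + b)) / (real m + b) - ln (1 + x / (real m + b)) / (real m + b)"
        by (simp only: quot diff_divide_distrib)
    qed
    also have "(\<Sum>m. ln (1 + 2 * x / (real m + b)) / (real m + b) - ln (1 + x / (real m + b)) / (real m + b))
        = ?L (2 * x) - ?L x"
      using sums_diff[OF shifted_ln_sum_sums_and_deriv(1)[OF b bx(2)]
          shifted_ln_sum_sums_and_deriv(1)[OF b bx(1)]]
      by (simp add: sums_iff)
    finally show ?thesis .
  qed

  \<comment> \<open>The condition \<open>x \<le> a / 2\<close> is \<open>x \<le> b\<close>, the
    closed endpoint of the alternating series.\<close>
  have T1: "T1 sums ?L x" if "x \<le> a / 2"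
    unfolding T1_def b_def[symmetric]
    using that bx b by (intro alternating_hurwitz_zeta_series) (auto simp: b_def)
  \<comment> \<open>The condition \<open>x \<le> a / 3\<close> is \<open>2 * x \<le> b\<close>. The
    factor \<open>2 ^ (k + 1) - 1\<close> makes the series the difference of the alternating series
    at \<open>2 * x\<close> and at \<open>x\<close>.\<close>
  have T2: "T2 sums (?L (2 * x) - ?L x)" if "x \<le> a / 3"
  proof -
    have "(\<lambda>k. (-1) ^ k * hurwitz_zeta (real (k + 1) + 1) b / real (k + 1) * (2 * x) ^ (k + 1)
            - (-1) ^ k * hurwitz_zeta (real (k + 1) + 1) b / real (k + 1) * x ^ (k + 1))
          sums (?L (2 * x) - ?L x)"
      using that bx b assms(1)
      by (intro sums_diff alternating_hurwitz_zeta_series) (auto simp: b_def)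
    then show ?thesis
      unfolding T2_def b_def[symmetric] by (simp add: algebra_simps diff_divide_distrib power_mult_distrib)
  qed

  have zeta: "hurwitz_zeta (real (k + 1) + 1) b \<ge> 1 / b ^ (k + 2)" for k
    using hurwitz_zeta_ge_head[OF b, of "k + 1"] by simp
  have zeta0: "hurwitz_zeta (real (k + 1) + 1) b \<ge> 0" for k
    using order_trans[OF _ zeta[of k]] b by simp
  have nT1: "\<not> summable T1" if "x > a / 2"
  \<comment> \<open>The head \<open>1 / b ^ (k + 2)\<close> of the zeta value supplies the ratio
    \<open>x / b\<close> and one spare factor \<open>1 / b\<close>.\<close>
  proof (rule not_summable_power_over_nat[of "x / b" "1 / b"])
    have x: "x > 0" using that assms(1) by simp
    show "x / b > 1" using that b by (simp add: b_def field_simps)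
    show "\<bar>T1 k\<bar> \<ge> 1 / b * (x / b) ^ (k + 1) / real (k + 1)" for k
    proof -
      have "1 / b * (x / b) ^ (k + 1) / real (k + 1) = 1 / b ^ (k + 2) * (x ^ (k + 1) / real (k + 1))"
        by (simp add: power_divide)
      also have "\<dots> \<le> hurwitz_zeta (real (k + 1) + 1) b * (x ^ (k + 1) / real (k + 1))"
        using x by (intro mult_right_mono zeta) auto
      also have "\<dots> \<le> \<bar>T1 k\<bar>"
        unfolding T1_def b_def[symmetric] using x zeta0[of k] by (simp add: abs_mult)
      finally show ?thesis .
    qed
  qed (use b in simp)
  have nT2: "\<not> summable T2" if "x > a / 3"
  \<comment> \<open>The estimate \<open>2 ^ (k + 1) - 1 \<ge> 2 ^ k\<close> costs a factor 2, hence
    the constant \<open>1 / (2 * b)\<close>.\<close>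
  proof (rule not_summable_power_over_nat[of "2 * x / b" "1 / (2 * b)"])
    have x: "x > 0" using that assms(1) by simp
    show "2 * x / b > 1" using that b by (simp add: b_def field_simps)
    show "\<bar>T2 k\<bar> \<ge> 1 / (2 * b) * (2 * x / b) ^ (k + 1) / real (k + 1)" for k
    proof -
      have p: "(2::real) ^ k \<le> 2 ^ (k + 1) - 1" "(0::real) \<le> 2 ^ (k + 1) - 1"
        using one_le_power[of "2::real" k] unfolding power_add power_one_right by linarith+
      have "1 / (2 * b) * (2 * x / b) ^ (k + 1) / real (k + 1)
          = 2 ^ k * (1 / b ^ (k + 2)) * (x ^ (k + 1) / real (k + 1))"
        by (simp add: power_divide power_mult_distrib)
      also have "\<dots> \<le> (2 ^ (k + 1) - 1) * hurwitz_zeta (real (k + 1) + 1) b * (x ^ (k + 1) / real (k + 1))"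
        using x b by (intro mult_right_mono mult_mono zeta p) auto
      also have "\<dots> \<le> \<bar>T2 k\<bar>"
        unfolding T2_def b_def[symmetric]
        using x zeta0[of k] p(2) by (simp add: abs_mult)
      finally show ?thesis .
    qed
  qed (use b in simp)

  have "summable T1 \<longleftrightarrow> x \<le> a / 2"
    using sums_summable[OF T1] nT1 by (meson not_le)
  moreover have "summable T2 \<longleftrightarrow> x \<le> a / 3"
    using sums_summable[OF T2] nT2 by (meson not_le)
  ultimately show ?thesis
    unfolding I1 I2 using f1(1) f2(1) S1 S2 T1 T2 by simp
qed

end
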